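(* Let $W$ be an infinite word over $\{0,1\}$ that is uniformly recurrent, aperiodic, and generated by a uniform morphism. Then there is a constant $C=C(W)$ such that for all positive integers $i$ and $k$, $W$ contains a $k$-anti-power with blocks of length at most $Ck$ beginning at its $i$-th position; that is, there is a positive integer $m\le Ck$ such that the $k$ words $[i+(j-1)m,\ i+jm-1]$, $j=1,\ldots,k$, are pairwise distinct.
   Context: Infinite words are infinite to the right only, with positions indexed by $1,2,3,\ldots$; $[p,q]$ denotes the factor (contiguous subword) of $W$ that starts in position $p$ and ends in position $q$. $\mathcal A^*$ is the set of all finite words over $\mathcal A$. A morphism is a map $\mu:\mathcal A^*\to\mathcal A^*$ with $\mu(ww')=\mu(w)\mu(w')$ for all $w,w'\in\mathcal A^*$. It is $r$-uniform if $\mu(a)$ has length $r$ for every $a\in\mathcal A$, and uniform if it is $r$-uniform for some $r$. It is prolongable at $a\in\mathcal A$ if $\mu(a)=as$ for some nonempty word $s$; in that case the sequence $a,\mu(a),\mu^2(a),\ldots$ converges to an infinite word $\mu^\omega(a)$. An infinite word $W$ over $\mathcal A$ is generated by $\mu:\mathcal A^*\to\mathcal A^*$ if $W=\mu^\omega(a)$ for some letter $a\in\mathcal A$ at which $\mu$ is prolongable; here $\mathcal A=\{0,1\}$. An infinite word is aperiodic if it is not eventually periodic. An infinite word $W$ is uniformly recurrent if for every finite factor $w$ of $W$ there is a positive integer $n$ such that every factor of $W$ of length $n$ contains $w$ as a factor. A $k$-anti-power is a word formed by concatenating $k$ consecutive words (called blocks) that all have the same length and are pairwise distinct. *)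

theory Defs
  imports Complex_Main "HOL-Library.Omega_Words_Fun" "HOL-Library.Sublist" "HOL-Library.Z2"
begin

text \<open>
  Infinite words are functions on \<open>nat\<close>. Positions are counted from 1, so that the letter of
  \<open>W\<close> in position \<open>n\<close> is \<open>W (n - 1)\<close>; a position is always assumed to be at least 1.
  The two-letter alphabet is \<^typ>\<open>bit\<close>, whose only elements are \<open>0\<close> and \<open>1\<close>
  (its arithmetic is not used).
\<close>

text \<open>
  The factor \<open>[p, q]\<close>, inclusive at both ends; it is empty if \<open>q < p\<close>.
\<close>

definition factor :: "'a word \<Rightarrow> nat \<Rightarrow> nat \<Rightarrow> 'a list" where
  "factor W p q = subsequence W (p - 1) q"

definition is_factor :: "'a list \<Rightarrow> 'a word \<Rightarrow> bool" where
  "is_factor w W \<longleftrightarrow> (\<exists>p q. 1 \<le> p \<and> w = factor W p q)"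

definition morphism :: "('a list \<Rightarrow> 'a list) \<Rightarrow> bool" where
  "morphism \<mu> \<longleftrightarrow> (\<forall>w w'. \<mu> (w @ w') = \<mu> w @ \<mu> w')"

definition uniform :: "('a list \<Rightarrow> 'a list) \<Rightarrow> bool" where
  "uniform \<mu> \<longleftrightarrow> (\<exists>r. \<forall>a. length (\<mu> [a]) = r)"

definition prolongable_at :: "('a list \<Rightarrow> 'a list) \<Rightarrow> 'a \<Rightarrow> bool" where
  "prolongable_at \<mu> a \<longleftrightarrow> (\<exists>s. s \<noteq> [] \<and> \<mu> [a] = a # s)"

text \<open>
  Convergence of finite words to an infinite word: every fixed position is eventually present
  and eventually carries the letter of the limit.
\<close>

definition converges_to :: "(nat \<Rightarrow> 'a list) \<Rightarrow> 'a word \<Rightarrow> bool" where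
  "converges_to u W \<longleftrightarrow> (\<forall>n. \<forall>\<^sub>F k in sequentially. n < length (u k) \<and> u k ! n = W n)"

lemma converges_to_unique:
  assumes "converges_to u V" "converges_to u W"
  shows "V = W"
proof
  fix n
  have "\<forall>\<^sub>F k in sequentially. n < length (u k) \<and> u k ! n = V n"
    and "\<forall>\<^sub>F k in sequentially. n < length (u k) \<and> u k ! n = W n"
    using assms by (simp_all add: converges_to_def)
  then have "\<forall>\<^sub>F k in sequentially. V n = W n"
    by eventually_elim simp
  then show "V n = W n"
    by simp
qed

definition generated_by :: "'a word \<Rightarrow> ('a list \<Rightarrow> 'a list) \<Rightarrow> bool" where
  "generated_by W \<mu> \<longleftrightarrow>
     morphism \<mu> \<and> (\<exists>a. prolongable_at \<mu> a \<and> converges_to (\<lambda>n. (\<mu> ^^ n) [a]) W)"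

definition eventually_periodic :: "'a word \<Rightarrow> bool" where
  "eventually_periodic W \<longleftrightarrow> (\<exists>p N. 0 < p \<and> (\<forall>n\<ge>N. W (n + p) = W n))"

definition aperiodic :: "'a word \<Rightarrow> bool" where
  "aperiodic W \<longleftrightarrow> \<not> eventually_periodic W"

definition uniformly_recurrent :: "'a word \<Rightarrow> bool" where
  "uniformly_recurrent W \<longleftrightarrow>
     (\<forall>w. is_factor w W \<longrightarrow>
        (\<exists>n>0. \<forall>v. is_factor v W \<and> length v = n \<longrightarrow> sublist w v))"

definition anti_power :: "nat \<Rightarrow> 'a list \<Rightarrow> bool" where
  "anti_power k w \<longleftrightarrow>
     (\<exists>bs m. w = concat bs \<and> length bs = k \<and> (\<forall>b\<in>set bs. length b = m) \<and> distinct bs)"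

end

theory Submission
  imports Defs "HOL-Number_Theory.Cong"
begin

text \<open>
  Let \<open>W\<close> be fixed by the \<open>r\<close>-uniform morphism \<open>\<mu>\<close>. The point is a weak form of recognizability
  that is uniform in \<open>n\<close>: there are \<open>L\<close> and \<open>F\<close> such that a word of length \<open>L r\<^sup>n\<close> occurring at
  two positions of \<open>W\<close> at distance \<open>d\<close> forces \<open>r\<^sup>n\<close> to divide \<open>F d\<close>.

  Uniform recurrence gives \<open>c\<close> such that every window of length \<open>c r\<^sup>n\<close> contains all factors of
  length at most \<open>r\<^sup>n + 1\<close>. A period \<open>h \<le> r\<^sup>n\<close> of such a window would therefore be a period of \<open>W\<close>.
  Now let a much longer window recur at distance \<open>d\<close>. Using recurrence, the shift by \<open>d\<close> can be
  iterated, which gives occurrences of one word of length \<open>c r\<^sup>n\<close> at positions congruent to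
  \<open>p + j d\<close> modulo \<open>r\<^sup>n\<close> for all \<open>j \<le> K\<close>. Each of these lies in the image under \<open>\<mu>\<^sup>n\<close> of a factor of
  length \<open>c + 1\<close>, so if \<open>K\<close> is large then two of them lie in the image of the same factor. Their
  offsets coincide, as otherwise the word would have a period less than \<open>r\<^sup>n\<close>. Hence \<open>r\<^sup>n\<close> divides
  \<open>g d\<close> for some \<open>1 \<le> g \<le> K\<close>, and \<open>F = K!\<close> works.
\<close>

section \<open>Agreeing windows, at positions counted from 0\<close>

definition agree :: "'a word \<Rightarrow> nat \<Rightarrow> nat \<Rightarrow> nat \<Rightarrow> bool" where
  "agree W l x y \<longleftrightarrow> (\<forall>s<l. W (x + s) = W (y + s))"

lemma agreeD: "agree W l x y \<Longrightarrow> s < l \<Longrightarrow> W (x + s) = W (y + s)"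
  by (simp add: agree_def)

lemma agree_sym: "agree W l x y \<Longrightarrow> agree W l y x"
  by (simp add: agree_def)

lemma agree_trans: "agree W l x y \<Longrightarrow> agree W l y z \<Longrightarrow> agree W l x z"
  by (simp add: agree_def)

lemma agree_mono: "agree W l x y \<Longrightarrow> l' \<le> l \<Longrightarrow> agree W l' x y"
  by (simp add: agree_def)

lemma agree_shift: "agree W l x y \<Longrightarrow> t + l' \<le> l \<Longrightarrow> agree W l' (x + t) (y + t)"
  unfolding agree_def by (metis add.assoc add_less_cancel_left order_less_le_trans)

lemma agree_iff_subsequence:
  "agree W l x y \<longleftrightarrow> subsequence W x (x + l) = subsequence W y (y + l)"
  by (simp add: agree_def list_eq_iff_nth_eq)

text \<open>\<open>block\<close> is the trace of the morphism: the block of \<open>r\<close> letters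
  at \<open>x * r\<close> depends on \<open>W x\<close> alone. In \<open>recurrent\<close>, one
  bound \<open>R\<close> serves all words of length \<open>l\<close>.\<close>

locale recurrent_block_word =
  fixes W :: "'a word" and r :: nat
  assumes finite_range: "finite (range W)"
    and r_ge_2: "2 \<le> r"
    and block: "W x = W y \<Longrightarrow> agree W r (x * r) (y * r)"
    and recurrent: "\<exists>R. \<forall>x y. \<exists>z. y \<le> z \<and> z \<le> y + R \<and> agree W l x z"
    and aperiodic: "aperiodic W"
begin

text \<open>The letter at \<open>x * r ^ Suc n + s\<close> has index \<open>s mod r\<close> in the
  block of the letter at \<open>x * r ^ n + s div r\<close>.\<close>

lemma block_power: "W x = W y \<Longrightarrow> s < r ^ n \<Longrightarrow> W (x * r ^ n + s) = W (y * r ^ n + s)"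
proof (induction n arbitrary: s)
  case (Suc n)
  have "s div r < r ^ n"
    using Suc.prems r_ge_2 by (simp add: less_mult_imp_div_less mult.commute)
  then have "W (x * r ^ n + s div r) = W (y * r ^ n + s div r)"
    using Suc by blast
  then have "agree W r ((x * r ^ n + s div r) * r) ((y * r ^ n + s div r) * r)"
    by (rule block)
  moreover have "s mod r < r"
    using r_ge_2 by simp
  ultimately have "W ((x * r ^ n + s div r) * r + s mod r) = W ((y * r ^ n + s div r) * r + s mod r)"
    by (rule agreeD)
  then show ?case
    by (simp add: algebra_simps)
qed simp

lemma agree_power:
  assumes "agree W l x y"
  shows "agree W (l * r ^ n) (x * r ^ n) (y * r ^ n)"
  unfolding agree_def
proof (intro allI impI)
  fix s assume s: "s < l * r ^ n"
  have "s div r ^ n < l" "s mod r ^ n < r ^ n"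
    using s r_ge_2 by (simp_all add: less_mult_imp_div_less)
  then have "W ((x + s div r ^ n) * r ^ n + s mod r ^ n) = W ((y + s div r ^ n) * r ^ n + s mod r ^ n)"
    using assms by (intro block_power agreeD)
  then show "W (x * r ^ n + s) = W (y * r ^ n + s)"
    by (simp add: algebra_simps)
qed

section \<open>Periods, recognizability and distinct blocks\<close>

text \<open>As \<open>h \<le> r ^ n\<close>, positions \<open>x\<close> and \<open>x + h\<close> lie
  in two adjacent blocks. A copy of these blocks occurs in the window, whose period then passes to
  \<open>x\<close>.\<close>

lemma no_short_period:
  obtains c where "\<And>n X h. 0 < h \<Longrightarrow> h \<le> r ^ n \<Longrightarrow> \<not> agree W (c * r ^ n) X (X + h)"
proof -
  obtain R where R: "\<And>x y. \<exists>z. y \<le> z \<and> z \<le> y + R \<and> agree W 2 x z"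
    using recurrent[of 2] by blast
  show thesis
  proof
    fix n X h
    assume h: "0 < h" "h \<le> r ^ n"
    \<comment> \<open>Rounding \<open>X\<close> up to a block boundary costs at most one block,
      waiting for recurrence \<open>R\<close>, and the copy itself two.\<close>
    show "\<not> agree W ((R + 3) * r ^ n) X (X + h)"
    proof
      assume per: "agree W ((R + 3) * r ^ n) X (X + h)"
      have "W (x + h) = W x" for x
      proof -
        define q o1 where "q = r ^ n" and "o1 = x mod q"
        have q: "0 < q" "o1 < q"
          using r_ge_2 by (simp_all add: q_def o1_def)
        have x: "x = x div q * q + o1"
          by (simp add: o1_def)
        obtain z where z: "X div q + 1 \<le> z" "z \<le> X div q + 1 + R" "agree W 2 (x div q) z"
          using R by blast
        have "agree W (2 * q) (x div q * q) (z * q)"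
          using agree_power[OF z(3)] by (simp add: q_def)
        then have eq: "W (x div q * q + t) = W (z * q + t)" if "t < 2 * q" for t
          using that by (rule agreeD)
        have "X < (X div q + 1) * q"
          using q by (metis dividend_less_div_times add.commute add_mult_distrib mult_1)
        then have lo: "X \<le> z * q + o1"
          using z(1) by (meson less_or_eq_imp_le mult_le_mono1 order_trans trans_le_add1)
        have "z * q \<le> (X div q + 1 + R) * q"
          using z(2) by (rule mult_le_mono1)
        also have "\<dots> \<le> X + (R + 1) * q"
          by (simp add: algebra_simps)
        finally have "z * q + o1 - X < (R + 3) * q"
          using q lo by (simp add: algebra_simps)
        then have "W (X + (z * q + o1 - X)) = W (X + h + (z * q + o1 - X))"
          using agreeD[OF per] by (simp add: q_def)
        then have "W (z * q + o1) = W (z * q + (o1 + h))"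
          using lo by (simp add: algebra_simps)
        then have "W (x div q * q + o1) = W (x div q * q + (o1 + h))"
          using eq[of o1] eq[of "o1 + h"] q h by (simp add: q_def)
        then show ?thesis
          using x by (metis add.assoc)
      qed
      then show False
        using aperiodic h unfolding aperiodic_def eventually_periodic_def by blast
    qed
  qed
qed

text \<open>
  A shift by \<open>d\<close> between two occurrences of a long window can be repeated: recurrence moves the
  occurrence just found back into the original window without changing its position modulo \<open>r ^ n\<close>.
\<close>

lemma repeated_shifts:
  "\<exists>L. \<forall>n p d. agree W (L * r ^ n) p (p + d) \<longrightarrow>
     (\<forall>j\<le>K. \<exists>y. agree W (c * r ^ n) p y \<and> [y = p + j * d] (mod r ^ n))"
proof (induction K)
  case 0
  show ?case
    by (auto simp: agree_def intro: cong_refl)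
next
  case (Suc K)
  then obtain L where L: "\<And>n p d j. agree W (L * r ^ n) p (p + d) \<Longrightarrow> j \<le> K \<Longrightarrow>
      \<exists>y. agree W (c * r ^ n) p y \<and> [y = p + j * d] (mod r ^ n)"
    by blast
  obtain R where R: "\<And>x y. \<exists>z. y \<le> z \<and> z \<le> y + R \<and> agree W (c + 1) x z"
    using recurrent[of "c + 1"] by blast
  \<comment> \<open>\<open>L\<close> serves the induction hypothesis. The other bound covers the
    moved copy: it starts in a block beginning at most \<open>R + 1\<close> blocks after
    \<open>p\<close>, at an offset below one block, and has \<open>c\<close> blocks of
    length.\<close>
  define L' where "L' = max L (R + c + 2)"
  have "\<exists>y. agree W (c * r ^ n) p y \<and> [y = p + j * d] (mod r ^ n)"
    if ag: "agree W (L' * r ^ n) p (p + d)" and j: "j \<le> Suc K" for n p d j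
  proof -
    define q where "q = r ^ n"
    have q: "0 < q"
      using r_ge_2 by (simp add: q_def)
    have ag1: "agree W (L * q) p (p + d)" and ag2: "agree W ((R + c + 2) * q) p (p + d)"
      by (rule agree_mono[OF ag], unfold L'_def q_def, rule mult_le_mono1, simp)+
    show ?thesis
    proof (cases "j \<le> K")
      case True
      then show ?thesis
        using L ag1 by (simp add: q_def)
    next
      case False
      then have jK: "j = Suc K"
        using j by simp
      obtain y where y: "agree W (c * q) p y" "[y = p + K * d] (mod q)"
        using L[of n p d K] ag1 unfolding q_def by blast
      define o1 where "o1 = y mod q"
      have o1: "o1 < q" "y = y div q * q + o1"
        using q by (simp_all add: o1_def)
      \<comment> \<open>\<open>c + 1\<close> whole blocks cover a window of length
        \<open>c * q\<close> at any offset \<open>o1 < q\<close>; keeping that offset in the copy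
        preserves the residue.\<close>
      obtain z where z: "p div q + 1 \<le> z" "z \<le> p div q + 1 + R" "agree W (c + 1) (y div q) z"
        using R by blast
      define y' where "y' = z * q + o1"
      have "agree W ((c + 1) * q) (y div q * q) (z * q)"
        using agree_power[OF z(3)] by (simp add: q_def)
      then have "agree W (c * q) (y div q * q + o1) y'"
        unfolding y'_def by (rule agree_shift) (use o1 in \<open>simp add: algebra_simps\<close>)
      then have yy': "agree W (c * q) y y'"
        using o1 by metis
      have "p < (p div q + 1) * q"
        using q by (metis dividend_less_div_times add.commute add_mult_distrib mult_1)
      then have lo: "p \<le> y'"
        using z(1) unfolding y'_def by (meson less_or_eq_imp_le mult_le_mono1 order_trans trans_le_add1)
      have "z * q \<le> (p div q + 1 + R) * q"
        using z(2) by (rule mult_le_mono1)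
      also have "\<dots> \<le> p + (R + 1) * q"
        by (simp add: algebra_simps)
      finally have hi: "(y' - p) + c * q \<le> (R + c + 2) * q"
        using o1 lo unfolding y'_def by (simp add: algebra_simps)
      have "agree W (c * q) (p + (y' - p)) (p + d + (y' - p))"
        using ag2 hi by (rule agree_shift)
      then have "agree W (c * q) y' (y' + d)"
        using lo by (simp add: algebra_simps)
      then have "agree W (c * q) p (y' + d)"
        using y(1) yy' agree_trans by blast
      moreover have "[y' + d = p + j * d] (mod q)"
      proof -
        have "[y' = y] (mod q)"
          by (simp add: y'_def o1_def cong_def)
        then have "[y' + d = p + K * d + d] (mod q)"
          using y(2) by (intro cong_add) (auto intro: cong_trans)
        then show ?thesis
          by (simp add: jK algebra_simps)
      qed
      ultimately show ?thesis
        by (auto simp: q_def)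
    qed
  qed
  then show ?case
    by blast
qed

text \<open>Neither \<open>L\<close> nor \<open>F\<close> depends on \<open>n\<close>; this
  uniformity makes the final bound linear in \<open>k\<close>.\<close>

lemma weak_recognizability:
  obtains L F :: nat where "0 < F"
    and "\<And>n p d. agree W (L * r ^ n) p (p + d) \<Longrightarrow> r ^ n dvd F * d"
proof -
  obtain c where c: "\<And>n X h. 0 < h \<Longrightarrow> h \<le> r ^ n \<Longrightarrow> \<not> agree W (c * r ^ n) X (X + h)"
    using no_short_period by metis
  define U :: "'a list set" where "U = {w. set w \<subseteq> range W \<and> length w = c + 1}"
  have finU: "finite U"
    unfolding U_def by (rule finite_lists_length_eq[OF finite_range])
  \<comment> \<open>The \<open>K + 1\<close> indices from 0 to \<open>K\<close> have codes in a set
    of \<open>K\<close> words, so two codes coincide.\<close>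
  define K where "K = card U"
  obtain L where L: "\<And>n p d j. agree W (L * r ^ n) p (p + d) \<Longrightarrow> j \<le> K \<Longrightarrow>
      \<exists>y. agree W (c * r ^ n) p y \<and> [y = p + j * d] (mod r ^ n)"
    using repeated_shifts[of K c] by blast
  show thesis
  proof
    show "0 < (fact K :: nat)"
      by simp
    fix n p d
    assume ag: "agree W (L * r ^ n) p (p + d)"
    define q where "q = r ^ n"
    have q: "0 < q"
      using r_ge_2 by (simp add: q_def)
    have "\<forall>j\<in>{..K}. \<exists>y. agree W (c * q) p y \<and> [y = p + j * d] (mod q)"
      using L[OF ag] by (simp add: q_def)
    then obtain y where y: "\<And>j. j \<le> K \<Longrightarrow> agree W (c * q) p (y j)"
        "\<And>j. j \<le> K \<Longrightarrow> [y j = p + j * d] (mod q)"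
      by (metis atMost_iff bchoice)
    define u where "u j = subsequence W (y j div q) (y j div q + (c + 1))" for j
    have "u ` {..K} \<subseteq> U"
      by (auto simp: u_def U_def)
    then have "card (u ` {..K}) < card {..K}"
      using card_mono[OF finU] by (simp add: K_def le_imp_less_Suc)
    then have "\<not> inj_on u {..K}"
      by (rule pigeonhole)
    then obtain j j' where jj: "j < j'" "j' \<le> K" "u j = u j'"
      by (auto simp: inj_on_def) (metis less_imp_le linorder_neqE_nat)
    \<comment> \<open>With equal codes, the larger offset can be used in the blocks of
      \<open>y a\<close>. The word then occurs both at \<open>y a\<close> and less than
      \<open>q\<close> later, a period excluded by \<open>c\<close>.\<close>
    have same_offset: "\<not> y a mod q < y b mod q" if "a \<le> K" "b \<le> K" "u a = u b" for a b
    proof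
      assume less: "y a mod q < y b mod q"
      have "agree W (c + 1) (y a div q) (y b div q)"
        using \<open>u a = u b\<close> by (simp add: u_def agree_iff_subsequence)
      then have "agree W ((c + 1) * q) (y a div q * q) (y b div q * q)"
        unfolding q_def by (rule agree_power)
      then have "agree W (c * q) (y a div q * q + y b mod q) (y b div q * q + y b mod q)"
        by (rule agree_shift) (use q in \<open>simp add: algebra_simps less_imp_le\<close>)
      then have "agree W (c * q) (y a div q * q + y b mod q) (y b)"
        by simp
      moreover have "agree W (c * q) (y b) (y a)"
        using y(1)[OF that(1)] y(1)[OF that(2)] agree_sym agree_trans by blast
      moreover have "y a div q * q + y b mod q = y a + (y b mod q - y a mod q)"
        using less by (metis add_diff_inverse_nat div_mult_mod_eq group_cancel.add1 less_imp_not_less)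
      ultimately have "agree W (c * q) (y a) (y a + (y b mod q - y a mod q))"
        using agree_sym agree_trans by metis
      moreover have "y b mod q - y a mod q \<le> r ^ n"
        using q mod_less_divisor[of q "y b"] unfolding q_def by linarith
      ultimately show False
        using c less unfolding q_def by (metis zero_less_diff)
    qed
    then have "y j mod q = y j' mod q"
      using jj by (metis le_trans less_imp_le linorder_neqE_nat)
    then have "[p + j' * d = p + j * d] (mod q)"
      using y(2)[of j] y(2)[of j'] jj by (simp add: cong_def)
    then have "[j' * d = j * d] (mod q)"
      by (simp add: cong_add_lcancel_nat)
    then have "q dvd (j' - j) * d"
      using jj by (simp add: cong_altdef_nat diff_mult_distrib)
    \<comment> \<open>The factorial absorbs every possible gap \<open>j' - j\<close>.\<close>
    moreover have "j' - j dvd fact K"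
      using jj by (intro dvd_fact) auto
    ultimately show "r ^ n dvd fact K * d"
      unfolding q_def by (meson dvd_refl dvd_trans mult_dvd_mono)
  qed
qed

text \<open>
  A block length \<open>m \<equiv> 1 (mod r ^ n)\<close> turns equality of the blocks number \<open>j < j'\<close> into
  \<open>r ^ n dvd F * (j' - j)\<close>, which is impossible once \<open>F * k < r ^ n\<close>.
\<close>

lemma distinct_blocks:
  obtains C :: nat where "\<And>k. 1 \<le> k \<Longrightarrow>
    \<exists>m\<ge>1. m \<le> C * k \<and> (\<forall>i j j'. j < j' \<longrightarrow> j' < k \<longrightarrow> \<not> agree W m (i + j * m) (i + j' * m))"
proof -
  obtain L F :: nat where F: "0 < F"
    and L: "\<And>n p d. agree W (L * r ^ n) p (p + d) \<Longrightarrow> r ^ n dvd F * d"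
    using weak_recognizability by metis
  show thesis
  proof
    fix k :: nat
    assume k: "1 \<le> k"
    \<comment> \<open>Minimality of \<open>n\<close> gives \<open>r ^ n \<le> r * F * k\<close>,
      which keeps \<open>m\<close> linear in \<open>k\<close>.\<close>
    define n where "n = (LEAST n. F * k < r ^ n)"
    have "F * k < r ^ (F * k)"
      using r_ge_2 by (simp add: power_gt_expt)
    then have n: "F * k < r ^ n"
      unfolding n_def by (rule LeastI)
    then have "n \<noteq> 0"
      using F k by (metis One_nat_def less_one mult_is_0 not_less0 not_one_le_zero power_0 neq0_conv)
    then obtain n' where n': "n = Suc n'"
      using not0_implies_Suc by blast
    then have "r ^ n' \<le> F * k"
      using not_less_Least[of n' "\<lambda>n. F * k < r ^ n"] by (simp add: n_def)
    then have "L * r ^ n \<le> L * (r * (F * k))"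
      unfolding n' power_Suc by (intro mult_le_mono order_refl)
    define m where "m = L * r ^ n + 1"
    have "m \<le> (L * r * F + 1) * k"
      using add_mono[OF \<open>L * r ^ n \<le> L * (r * (F * k))\<close> k] unfolding m_def by (simp add: algebra_simps)
    moreover have "\<not> agree W m (i + j * m) (i + j' * m)" if "j < j'" "j' < k" for i j j'
    proof
      assume ag: "agree W m (i + j * m) (i + j' * m)"
      have "L * r ^ n \<le> m"
        by (simp add: m_def)
      then have "agree W (L * r ^ n) (i + j * m) (i + j' * m)"
        by (rule agree_mono[OF ag])
      moreover have "i + j' * m = i + j * m + (j' - j) * m"
        using that by (simp add: diff_mult_distrib)
      ultimately have "agree W (L * r ^ n) (i + j * m) (i + j * m + (j' - j) * m)"
        by simp
      then have "r ^ n dvd (F * (j' - j)) * m"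
        using L by (simp add: mult.assoc)
      moreover have "coprime (r ^ n) m"
        unfolding m_def by (metis coprime_iff_gcd_eq_1 gcd_1_nat gcd_add_mult mult.commute add.commute)
      ultimately have "r ^ n dvd F * (j' - j)"
        by (simp add: coprime_dvd_mult_left_iff)
      moreover have "0 < F * (j' - j)"
        using F that by simp
      ultimately have "r ^ n \<le> F * (j' - j)"
        by (rule dvd_imp_le)
      also have "\<dots> \<le> F * k"
        using that by (intro mult_le_mono2) linarith
      finally show False
        using n by simp
    qed
    ultimately show "\<exists>m\<ge>1. m \<le> (L * r * F + 1) * k \<and>
        (\<forall>i j j'. j < j' \<longrightarrow> j' < k \<longrightarrow> \<not> agree W m (i + j * m) (i + j' * m))"
      by (intro exI[of _ m]) (auto simp: m_def)
  qed
qed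

end

section \<open>From the hypotheses to the locale\<close>

text \<open>There are finitely many factors of length \<open>l\<close>, so the maximum of their
  individual recurrence bounds serves them all.\<close>

lemma uniformly_recurrent_bound:
  assumes "finite (range W)" "uniformly_recurrent W"
  shows "\<exists>R. \<forall>x y. \<exists>z. y \<le> z \<and> z \<le> y + R \<and> agree W l x z"
proof -
  define U where "U = {w. length w = l \<and> is_factor w W}"
  have "U \<subseteq> {w. set w \<subseteq> range W \<and> length w = l}"
    by (auto simp: U_def is_factor_def factor_def)
  then have "finite U"
    using finite_lists_length_eq[OF assms(1)] by (rule finite_subset)
  have "\<forall>w\<in>U. \<exists>n. \<forall>v. is_factor v W \<and> length v = n \<longrightarrow> sublist w v"
    using assms(2) by (auto simp: U_def uniformly_recurrent_def)
  then obtain N where N: "\<And>w v. w \<in> U \<Longrightarrow> is_factor v W \<Longrightarrow> length v = N w \<Longrightarrow> sublist w v"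
    by metis
  define R where "R = Max (insert 0 (N ` U))"
  have "\<exists>z. y \<le> z \<and> z \<le> y + R \<and> agree W l x z" for x y
  proof -
    have fac: "is_factor (subsequence W a (a + b)) W" for a b
      \<comment> \<open>\<open>factor\<close> counts from 1, hence the start \<open>Suc a\<close>;
        its inclusive end is the exclusive end counted from 0.\<close>
      unfolding is_factor_def factor_def by (intro exI[of _ "Suc a"] exI[of _ "a + b"]) simp
    define w where "w = subsequence W x (x + l)"
    have w: "w \<in> U"
      using fac by (simp add: U_def w_def)
    then have "N w \<le> R"
      using \<open>finite U\<close> by (simp add: R_def)
    have "sublist w (subsequence W y (y + N w))"
      using w fac by (intro N) auto
    then obtain a b where ab: "subsequence W y (y + N w) = a @ w @ b"
      by (auto simp: sublist_def)
    have len: "length a + l + length b = N w"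
      using arg_cong[OF ab, of length] by (simp add: w_def)
    have "W (x + s) = W (y + length a + s)" if "s < l" for s
    proof -
      have "W (y + (length a + s)) = subsequence W y (y + N w) ! (length a + s)"
        using that len by simp
      also have "\<dots> = w ! s"
        using that unfolding ab by (simp add: nth_append w_def)
      also have "\<dots> = W (x + s)"
        using that by (simp add: w_def)
      finally show ?thesis
        by (simp add: add.assoc)
    qed
    then have "agree W l x (y + length a)"
      by (simp add: agree_def)
    then show ?thesis
      using len \<open>N w \<le> R\<close> by (intro exI[of _ "y + length a"]) auto
  qed
  then show ?thesis
    by blast
qed

lemma length_uniform_morphism:
  assumes "morphism \<mu>" "\<And>a. length (\<mu> [a]) = r"
  shows "length (\<mu> w) = length w * r"
proof (induction w)
  case Nil
  have "\<mu> [] = \<mu> [] @ \<mu> []"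
    using assms(1) by (metis append_Nil morphism_def)
  then show ?case
    by simp
next
  case (Cons a w)
  have "\<mu> (a # w) = \<mu> [a] @ \<mu> w"
    using assms(1) by (metis append_Cons append_Nil morphism_def)
  then show ?case
    using Cons assms(2) by simp
qed

lemma nth_uniform_morphism:
  assumes "morphism \<mu>" "\<And>a. length (\<mu> [a]) = r" "x < length w" "s < r"
  shows "\<mu> w ! (x * r + s) = \<mu> [w ! x] ! s"
proof -
  have "\<mu> w = \<mu> (take x w) @ \<mu> [w ! x] @ \<mu> (drop (Suc x) w)"
    using assms(1,3) by (metis append_Cons append_Nil id_take_nth_drop morphism_def)
  then show ?thesis
    using assms by (simp add: nth_append length_uniform_morphism[OF assms(1,2)])
qed

text \<open>This is the fixed point equation for \<open>W\<close> in coordinates: iterates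
  \<open>k\<close> and \<open>Suc k\<close> are compared once both have settled at the relevant
  positions.\<close>

lemma generated_by_uniform_nth:
  assumes "generated_by W \<mu>" "\<And>a. length (\<mu> [a]) = r" "s < r"
  shows "W (x * r + s) = \<mu> [W x] ! s"
proof -
  obtain a where mor: "morphism \<mu>" and conv: "converges_to (\<lambda>n. (\<mu> ^^ n) [a]) W"
    using assms(1) by (auto simp: generated_by_def)
  have "\<forall>\<^sub>F k in sequentially. x < length ((\<mu> ^^ k) [a]) \<and> (\<mu> ^^ k) [a] ! x = W x"
    using conv by (simp add: converges_to_def)
  moreover have "\<forall>\<^sub>F k in sequentially. (\<mu> ^^ Suc k) [a] ! (x * r + s) = W (x * r + s)"
    using conv eventually_sequentially_Suc[of "\<lambda>k. (\<mu> ^^ k) [a] ! (x * r + s) = W (x * r + s)"]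
    by (auto simp: converges_to_def elim: eventually_mono)
  ultimately have "\<forall>\<^sub>F k in sequentially. W (x * r + s) = \<mu> [W x] ! s"
  proof eventually_elim
    case (elim k)
    then show ?case
      using nth_uniform_morphism[OF mor assms(2) _ assms(3), of x "(\<mu> ^^ k) [a]"] by simp
  qed
  then show ?thesis
    by simp
qed

section \<open>Assembling the anti-power\<close>

lemma concat_consecutive_subsequences:
  "concat (map (\<lambda>j. subsequence W (i + j * m) (i + j * m + m)) [0..<k]) = subsequence W i (i + k * m)"
proof (induction k)
  case (Suc k)
  have "[i..<i + Suc k * m] = [i..<i + k * m] @ [i + k * m..<i + k * m + m]"
    using upt_add_eq_append[of i "i + k * m" m] by (simp add: algebra_simps)
  then show ?case
    using Suc by (simp add: subsequence_def)
qed (simp add: subsequence_def)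

theorem theorem5:
  fixes W :: "bit word"
  assumes "uniformly_recurrent W"
    and "aperiodic W"
    and "\<exists>\<mu>. uniform \<mu> \<and> generated_by W \<mu>"
  shows "\<exists>C::real. \<forall>i k::nat. 1 \<le> i \<longrightarrow> 1 \<le> k \<longrightarrow>
           (\<exists>m::nat. 1 \<le> m \<and> real m \<le> C * real k \<and>
              anti_power k (factor W i (i + k * m - 1)) \<and>
              (\<forall>j\<in>{1..k}. \<forall>j'\<in>{1..k}. j \<noteq> j' \<longrightarrow>
                 factor W (i + (j - 1) * m) (i + j * m - 1) \<noteq>
                 factor W (i + (j' - 1) * m) (i + j' * m - 1)))"
proof -
  have "range W \<subseteq> {0, 1}"
    by (metis bit.exhaust insert_iff subsetI)
  then have fin: "finite (range W)"
    by (rule finite_subset) simp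
  obtain \<mu> r where gen: "generated_by W \<mu>" and r: "\<And>a. length (\<mu> [a]) = r"
    using assms(3) by (auto simp: uniform_def)
  \<comment> \<open>Prolongability makes the image of \<open>a\<close> longer than one
    letter.\<close>
  obtain a s where "s \<noteq> []" "\<mu> [a] = a # s"
    using gen by (auto simp: generated_by_def prolongable_at_def)
  then have "2 \<le> r"
    using r[of a] by (cases s) auto
  interpret recurrent_block_word W r
  proof
    show "agree W r (x * r) (y * r)" if "W x = W y" for x y
      using that generated_by_uniform_nth[OF gen r] by (simp add: agree_def)
  qed (use fin \<open>2 \<le> r\<close> assms uniformly_recurrent_bound in auto)
  obtain C where C: "\<And>k. 1 \<le> k \<Longrightarrow>
      \<exists>m\<ge>1. m \<le> C * k \<and> (\<forall>i j j'. j < j' \<longrightarrow> j' < k \<longrightarrow> \<not> agree W m (i + j * m) (i + j' * m))"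
    using distinct_blocks by metis
  show ?thesis
  proof (intro exI[of _ "real C"] allI impI)
    fix i k :: nat
    assume "1 \<le> i" "1 \<le> k"
    obtain m where m: "1 \<le> m" "m \<le> C * k"
      and "\<And>i j j'. j < j' \<Longrightarrow> j' < k \<Longrightarrow> \<not> agree W m (i + j * m) (i + j' * m)"
      using C[OF \<open>1 \<le> k\<close>] by blast
    then have ne: "\<not> agree W m (i + j * m) (i + j' * m)" if "j \<noteq> j'" "j < k" "j' < k" for i j j'
      using that by (metis agree_sym linorder_neqE_nat)
    obtain i0 where i: "i = Suc i0"
      using \<open>1 \<le> i\<close> by (cases i) auto
    \<comment> \<open>Blocks are numbered from 0 here, so \<open>b (j - 1)\<close> is the block with
      number \<open>j\<close> in the statement.\<close>
    define b where "b j = subsequence W (i0 + j * m) (i0 + j * m + m)" for j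
    have inj: "inj_on b {0..<k}"
      unfolding b_def agree_iff_subsequence[symmetric] inj_on_def using ne[of _ _ i0]
      by (metis atLeastLessThan_iff)
    have fac: "factor W (i + (j - 1) * m) (i + j * m - 1) = b (j - 1)" if "j \<in> {1..k}" for j
      using that by (cases j) (auto simp: i factor_def b_def algebra_simps)
    have "anti_power k (factor W i (i + k * m - 1))"
      unfolding anti_power_def
    proof (intro exI conjI)
      show "factor W i (i + k * m - 1) = concat (map b [0..<k])"
        using concat_consecutive_subsequences[of W i0 m k] unfolding b_def by (simp add: i factor_def)
      show "\<forall>w\<in>set (map b [0..<k]). length w = m"
        by (simp add: b_def)
      show "distinct (map b [0..<k])"
        using inj by (simp add: distinct_map)
    qed simp
    moreover have "\<forall>j\<in>{1..k}. \<forall>j'\<in>{1..k}. j \<noteq> j' \<longrightarrow>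
        factor W (i + (j - 1) * m) (i + j * m - 1) \<noteq> factor W (i + (j' - 1) * m) (i + j' * m - 1)"
    proof (intro ballI impI)
      fix j j'
      assume j: "j \<in> {1..k}" "j' \<in> {1..k}" "j \<noteq> j'"
      then have "b (j - 1) \<noteq> b (j' - 1)"
        using inj_onD[OF inj, of "j - 1" "j' - 1"] by (cases j; cases j') auto
      then show "factor W (i + (j - 1) * m) (i + j * m - 1) \<noteq> factor W (i + (j' - 1) * m) (i + j' * m - 1)"
        using fac j by simp
    qed
    moreover have "real m \<le> real C * real k"
      using m(2) by (simp flip: of_nat_mult)
    ultimately show "\<exists>m. 1 \<le> m \<and> real m \<le> real C * real k \<and>
              anti_power k (factor W i (i + k * m - 1)) \<and>
              (\<forall>j\<in>{1..k}. \<forall>j'\<in>{1..k}. j \<noteq> j' \<longrightarrow>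
                 factor W (i + (j - 1) * m) (i + j * m - 1) \<noteq>
                 factor W (i + (j' - 1) * m) (i + j' * m - 1))"
      using m(1) by blast
  qed
qed

end
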